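(* Let $n,B,d\in\mathbb N$, let $K$ be an even integer with $1\le K\le d$, let $h,\tau_{\mathrm s}>0$, $p_\sigma\in(0,1]$, and $\delta\in(0,1)$. Let $\{\eta_{b,i,k}\}$ and $\{\mu_{b,i,k}\}$ be random variables such that $$\mathbb P\left(\eta_{b,i,k}\le t\mid\eta_{b,i,k-1},\dots,\eta_{b,i,1},\mathcal G_{b-1}\right)\le t\,p_\sigma$$ for all $b\ge1$, $k\ge1$, $i\in[n]$, $t\ge0$, and $$\mathbb P\left(\mu_{b,i,k}\le t\mid\mu_{b,i,k-1},\dots,\mu_{b,i,1},\mathcal G_{b-1}\right)\le\frac{Kt}{\max\{d-\sum_{j=1}^{k-1}\mu_{b,i,j},\,0\}-t+1}$$ for all $b\ge1$, $k\ge1$, $i\in[n]$ and $0\le t\le\max\{d-\sum_{j=1}^{k-1}\mu_{b,i,j},0\}$, where $\mathcal G_{b-1}$ is the sigma-algebra generated by $\{\eta_{b',i,k}\}_{i\in[n],k\in[K/2],b'<b}$ and $\{\mu_{b',i,k}\}_{i\in[n],k\in[K/2],b'<b}$. Then $$\mathbb P\left(\sum_{b=1}^B\min_{i\in[n]}\left\{\min\left\{h\sum_{k=1}^{K/2}\eta_{b,i,k},\ \tau_{\mathrm s}\sum_{k=1}^{K/2}\mu_{b,i,k}\right\}\right\}\le\bar t\right)\le\delta$$ with $$\bar t:=\frac{BK+\log\delta}{e^4(2n)^{2/K}\left(4+\frac2K\log(2n)\right)}\min\left\{\frac{h}{p_\sigma},\frac{\tau_{\mathrm s}}{p_K}\right\},\qquad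 p_K:=\frac{2K}{d}.$$
   Context: $\mathbb N=\{1,2,\dots\}$, $[m]=\{1,\dots,m\}$. The random variables are indexed by $b\ge1$, $i\in[n]$, $k\ge1$, are defined on a common probability space, and the value $+\infty$ is allowed. *)

theory Defs
  imports "HOL-Probability.Probability"
begin

text \<open>The smallest sigma-algebra on the sample space of \<open>M\<close> making all members of \<open>XS\<close>
  measurable; it is trivial when \<open>XS\<close> is empty. (A supremum of \<open>vimage_algebra\<close>s would have the
  empty space in that case.)\<close>

definition sigma_rv :: "'a measure \<Rightarrow> ('a \<Rightarrow> ereal) set \<Rightarrow> 'a measure" where
  "sigma_rv M XS = sigma (space M) {X -` A \<inter> space M | X A. X \<in> XS \<and> A \<in> sets borel}"

definition sigma_join :: "'a measure \<Rightarrow> 'a measure \<Rightarrow> 'a measure \<Rightarrow> 'a measure" where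
  "sigma_join M F G = sigma (space M) (sets F \<union> sets G)"

text \<open>A version of the conditional probability of \<open>A\<close> given the sub-sigma-algebra \<open>F\<close>;
  determined almost everywhere only.\<close>

definition cond_pr :: "'a measure \<Rightarrow> 'a measure \<Rightarrow> 'a set \<Rightarrow> 'a \<Rightarrow> real" where
  "cond_pr M F A = real_cond_exp M F (indicator A)"

text \<open>\<open>G_before M n K \<eta> \<mu> b\<close> is $\mathcal G_{b-1}$: the indices \<open>b'\<close> range over
  \<open>{1..<b}\<close>, so it is trivial for \<open>b = 1\<close>.\<close>

definition G_before ::
  "'a measure \<Rightarrow> nat \<Rightarrow> nat \<Rightarrow> (nat \<Rightarrow> nat \<Rightarrow> nat \<Rightarrow> 'a \<Rightarrow> ereal) \<Rightarrow>
    (nat \<Rightarrow> nat \<Rightarrow> nat \<Rightarrow> 'a \<Rightarrow> ereal) \<Rightarrow> nat \<Rightarrow> 'a measure" where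
  "G_before M n K \<eta> \<mu> b = sigma_rv M
     ({\<eta> b' i k | b' i k. b' \<in> {1..<b} \<and> i \<in> {1..n} \<and> k \<in> {1..K div 2}} \<union>
      {\<mu> b' i k | b' i k. b' \<in> {1..<b} \<and> i \<in> {1..n} \<and> k \<in> {1..K div 2}})"

definition remaining ::
  "nat \<Rightarrow> (nat \<Rightarrow> nat \<Rightarrow> nat \<Rightarrow> 'a \<Rightarrow> ereal) \<Rightarrow> nat \<Rightarrow> nat \<Rightarrow> nat \<Rightarrow> 'a \<Rightarrow> ereal" where
  "remaining d \<mu> b i k \<omega> = max (ereal (real d) - (\<Sum>j\<in>{1..<k}. \<mu> b i j \<omega>)) 0"

definition p_K :: "nat \<Rightarrow> nat \<Rightarrow> real" where
  "p_K K d = 2 * real K / real d"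

definition t_bar ::
  "nat \<Rightarrow> nat \<Rightarrow> nat \<Rightarrow> nat \<Rightarrow> real \<Rightarrow> real \<Rightarrow> real \<Rightarrow> real \<Rightarrow> real" where
  "t_bar n B K d h \<tau>\<^sub>s p\<^sub>\<sigma> \<delta> =
     (real B * real K + ln \<delta>)
       / (exp 4 * (2 * real n) powr (2 / real K) * (4 + 2 / real K * ln (2 * real n)))
     * min (h / p\<^sub>\<sigma>) (\<tau>\<^sub>s / p_K K d)"

end

theory Submission imports Defs begin

text \<open>Chernoff's method with Laplace transforms. If \<open>P (X \<le> t | past) \<le> t * p\<close>, then writing
  \<open>exp (- l * X)\<close> as the integral of the exponential density over \<open>t \<ge> X\<close> gives
  \<open>E (exp (- l * X) | past) \<le> p / l\<close>, so the \<open>m = K / 2\<close> steps inside a block contribute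
  \<open>(p / l)^m\<close>. The exponential of a minimum over the \<open>2 * n\<close> candidates is at most the sum of
  their exponentials. Taking for \<open>s\<close> the reciprocal of the factor of \<open>B * K + ln \<delta>\<close> in
  \<open>t_bar\<close>, each block contributes at most \<open>exp (- K)\<close> to the Laplace transform at \<open>s\<close>, and
  Markov's inequality yields \<open>exp (s * t_bar) * exp (- B * K) = \<delta>\<close>.\<close>

section \<open>The exponential kernel on extended reals\<close>

text \<open>Junk value 1 at \<open>-\<infinity>\<close>.\<close>

definition exp_neg :: "real \<Rightarrow> ereal \<Rightarrow> ennreal" where
  "exp_neg l x = (if x = \<infinity> then 0 else ennreal (exp (- l * real_of_ereal x)))"

lemma exp_neg_ereal [simp]: "exp_neg l (ereal r) = ennreal (exp (- l * r))"
  by (simp add: exp_neg_def)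

lemma exp_neg_infinity [simp]: "exp_neg l \<infinity> = 0"
  by (simp add: exp_neg_def)

lemma exp_neg_0 [simp]: "exp_neg l 0 = 1"
  by (simp add: exp_neg_def)

lemma borel_measurable_exp_neg [measurable]: "exp_neg l \<in> borel_measurable borel"
  unfolding exp_neg_def[abs_def] by measurable

lemma exp_neg_add:
  assumes "x \<noteq> -\<infinity>" "y \<noteq> -\<infinity>"
  shows "exp_neg l (x + y) = exp_neg l x * exp_neg l y"
  using assms
  by (cases x; cases y) (auto simp: algebra_simps exp_add exp_diff exp_minus ennreal_mult[symmetric] field_simps)

lemma sum_ereal_not_MInfty:
  fixes x :: "'b \<Rightarrow> ereal"
  assumes "\<And>i. i \<in> I \<Longrightarrow> x i \<noteq> -\<infinity>"
  shows "sum x I \<noteq> -\<infinity>"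
  using assms by (induction I rule: infinite_finite_induct) auto

lemma exp_neg_sum:
  assumes "\<And>i. i \<in> I \<Longrightarrow> x i \<noteq> -\<infinity>"
  shows "exp_neg l (sum x I) = (\<Prod>i\<in>I. exp_neg l (x i))"
  using assms
proof (induction I rule: infinite_finite_induct)
  case (insert i I)
  then have "exp_neg l (x i + sum x I) = exp_neg l (x i) * exp_neg l (sum x I)"
    by (intro exp_neg_add sum_ereal_not_MInfty) auto
  with insert show ?case by simp
qed auto

lemma exp_neg_scale:
  assumes "0 < h" "x \<noteq> -\<infinity>"
  shows "exp_neg l (ereal h * x) = exp_neg (l * h) x"
  using assms by (cases x) (auto simp: mult_ac)

lemma exp_neg_antimono:
  assumes "0 < l" "x \<noteq> -\<infinity>" "x \<le> y"
  shows "exp_neg l y \<le> exp_neg l x"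
  using assms by (cases x; cases y) (auto intro!: ennreal_leI)

text \<open>An exponential variable with rate \<open>l\<close> exceeds \<open>x\<close> with
  probability \<open>exp (- l * x)\<close>. At \<open>x = \<infinity>\<close> the indicator
  vanishes, in agreement with \<open>exp_neg l \<infinity> = 0\<close>.\<close>

lemma exp_neg_eq_nn_integral:
  assumes l: "0 < l" and x: "0 \<le> x"
  shows "exp_neg l x = (\<integral>\<^sup>+t. ennreal (exponential_density l t) * indicator {t. x \<le> ereal t} t \<partial>lborel)"
proof (cases x)
  case (real r)
  then have r: "0 \<le> r" using x by simp
  have "(\<integral>\<^sup>+t. ennreal (exponential_density l t) * indicator {t. x \<le> ereal t} t \<partial>lborel)
    = (\<integral>\<^sup>+t. ennreal (l * exp (- l * t)) * indicator {r..} t \<partial>lborel)"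
    using r real by (intro nn_integral_cong)
      (auto simp: exponential_density_def mult_ac split: split_indicator)
  also have "\<dots> = 0 - (- exp (- l * r))"
  proof (rule nn_integral_FTC_atLeast)
    show "((\<lambda>t. - exp (- l * t)) has_real_derivative l * exp (- l * t)) (at t)" for t
      by (auto intro!: derivative_eq_intros)
    have "filterlim (\<lambda>t. - (l * t)) at_bot at_top"
      using filterlim_tendsto_pos_mult_at_top[OF tendsto_const l filterlim_ident]
      by (simp add: filterlim_uminus_at_top)
    then have "((\<lambda>t. exp (- (l * t))) \<longlongrightarrow> 0) at_top"
      by (rule filterlim_compose[OF exp_at_bot])
    from tendsto_minus[OF this] show "((\<lambda>t. - exp (- l * t)) \<longlongrightarrow> 0) at_top"
      by simp
  qed (use l in auto)
  finally show ?thesis using real by simp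
qed (use x in auto)

lemma nn_integral_exponential_density_mean:
  assumes "0 < l"
  shows "(\<integral>\<^sup>+t. ennreal (exponential_density l t) * ennreal t \<partial>lborel) = ennreal (1 / l)"
proof -
  have "(\<integral>\<^sup>+t. ennreal (exponential_density l t) * ennreal t \<partial>lborel)
    = (\<integral>\<^sup>+t. ennreal (exponential_density l t * t ^ 1) \<partial>lborel)"
    using assms by (intro nn_integral_cong) (auto simp: exponential_density_def ennreal_mult'[symmetric])
  also have "\<dots> = ennreal (1 / l)"
    \<comment> \<open>The exponential density is the Erlang density of shape 0; the factor
      \<open>t ^ 1\<close> displays the integral as its first moment.\<close>
    by (subst nn_integral_erlang_ith_moment) (use assms in \<open>auto simp: divide_ennreal[symmetric]\<close>)
  finally show ?thesis .
qed

section \<open>From distribution functions to Laplace transforms\<close>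

text \<open>Writing the kernel as an exponential tail and exchanging the integrals leaves the
  distribution function of \<open>X\<close>, averaged over an exponential time. The mean
  \<open>1 / l\<close> of that time turns the bound \<open>t * p\<close> into \<open>p / l\<close>.
  The weight \<open>Z\<close> stands for an arbitrary function of the past, so the inequality
  expresses a conditional bound through plain integrals.\<close>

lemma nn_integral_exp_neg_le:
  fixes X :: "'a \<Rightarrow> ereal"
  assumes "sigma_finite_measure M"
    and [measurable]: "X \<in> borel_measurable M" "Z \<in> borel_measurable M"
    and l: "0 < l" and p: "0 \<le> p" and pos: "AE \<omega> in M. 0 \<le> X \<omega>"
    and cdf: "\<And>t. 0 \<le> t \<Longrightarrow> (\<integral>\<^sup>+\<omega>. Z \<omega> * indicator {\<omega>\<in>space M. X \<omega> \<le> ereal t} \<omega> \<partial>M)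
                \<le> ennreal (t * p) * (\<integral>\<^sup>+\<omega>. Z \<omega> \<partial>M)"
  shows "(\<integral>\<^sup>+\<omega>. Z \<omega> * exp_neg l (X \<omega>) \<partial>M) \<le> ennreal (p / l) * (\<integral>\<^sup>+\<omega>. Z \<omega> \<partial>M)"
proof -
  interpret sigma_finite_measure M by fact
  interpret pair_sigma_finite lborel M ..
  let ?e = "\<lambda>t. ennreal (exponential_density l t)"
  have "(\<integral>\<^sup>+\<omega>. Z \<omega> * exp_neg l (X \<omega>) \<partial>M)
      = (\<integral>\<^sup>+\<omega>. (\<integral>\<^sup>+t. Z \<omega> * (?e t * indicator {t. X \<omega> \<le> ereal t} t) \<partial>lborel) \<partial>M)"
    using pos by (intro nn_integral_cong_AE) (auto simp: exp_neg_eq_nn_integral[OF l] nn_integral_cmult)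
  also have "\<dots> = (\<integral>\<^sup>+t. (\<integral>\<^sup>+\<omega>. Z \<omega> * (?e t * indicator {t. X \<omega> \<le> ereal t} t) \<partial>M) \<partial>lborel)"
    by (rule Fubini') measurable
  also have "\<dots> = (\<integral>\<^sup>+t. ?e t * (\<integral>\<^sup>+\<omega>. Z \<omega> * indicator {\<omega>\<in>space M. X \<omega> \<le> ereal t} \<omega> \<partial>M) \<partial>lborel)"
    by (auto intro!: nn_integral_cong simp: nn_integral_cmult[symmetric] mult_ac split: split_indicator)
  also have "\<dots> \<le> (\<integral>\<^sup>+t. (?e t * ennreal t) * (ennreal p * (\<integral>\<^sup>+\<omega>. Z \<omega> \<partial>M)) \<partial>lborel)"
  proof (rule nn_integral_mono)
    fix t :: real
    show "?e t * (\<integral>\<^sup>+\<omega>. Z \<omega> * indicator {\<omega>\<in>space M. X \<omega> \<le> ereal t} \<omega> \<partial>M)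
        \<le> (?e t * ennreal t) * (ennreal p * (\<integral>\<^sup>+\<omega>. Z \<omega> \<partial>M))"
      \<comment> \<open>The density vanishes at negative \<open>t\<close>, where \<open>cdf\<close>
        says nothing.\<close>
      using mult_left_mono[OF cdf[of t], of "?e t"] p
      by (cases "0 \<le> t") (auto simp: ennreal_mult mult_ac exponential_density_def)
  qed
  also have "\<dots> = ennreal (1 / l) * (ennreal p * (\<integral>\<^sup>+\<omega>. Z \<omega> \<partial>M))"
    by (subst nn_integral_multc) (auto simp: nn_integral_exponential_density_mean[OF l])
  also have "\<dots> = ennreal (p / l) * (\<integral>\<^sup>+\<omega>. Z \<omega> \<partial>M)"
    using l p by (simp add: mult.assoc[symmetric] ennreal_mult'[symmetric])
  finally show ?thesis .
qed

section \<open>Integration against conditional probabilities\<close>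

text \<open>\<open>real_cond_exp\<close> is the difference of the \<open>enn2real\<close> images of
  two nonnegative conditional expectations. For an indicator the subtracted one is 0, so
  \<open>cond_pr\<close> agrees almost everywhere with \<open>nn_cond_exp\<close>, whose defining
  integral identity then applies.\<close>

lemma (in finite_measure) nn_integral_mult_indicator_cond_pr:
  assumes sub: "subalgebra M F" and Z: "Z \<in> borel_measurable F" and A [measurable]: "A \<in> sets M"
  shows "(\<integral>\<^sup>+\<omega>. Z \<omega> * indicator A \<omega> \<partial>M) = (\<integral>\<^sup>+\<omega>. Z \<omega> * ennreal (cond_pr M F A \<omega>) \<partial>M)"
proof -
  interpret finite_measure_subalgebra M F
    by unfold_locales (rule sub)
  have neg: "(\<lambda>\<omega>. ennreal (- indicator A \<omega>)) = (\<lambda>_. 0)"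
    by (simp add: fun_eq_iff ennreal_neg)
  have "AE \<omega> in M. nn_cond_exp M F (\<lambda>_. 0) \<omega> = 0" "AE \<omega> in M. nn_cond_exp M F (\<lambda>_. 1) \<omega> = 1"
    using nn_cond_exp_F_meas[of "\<lambda>_. 0"] nn_cond_exp_F_meas[of "\<lambda>_. 1"] by auto
  \<comment> \<open>The bound by 1 excludes the value \<open>\<infinity>\<close>, which
    \<open>enn2real\<close> would send to 0.\<close>
  moreover have "AE \<omega> in M. nn_cond_exp M F (\<lambda>\<omega>. ennreal (indicator A \<omega>)) \<omega> \<le> nn_cond_exp M F (\<lambda>_. 1) \<omega>"
    by (rule nn_cond_exp_mono) (auto split: split_indicator)
  ultimately have "AE \<omega> in M. nn_cond_exp M F (\<lambda>\<omega>. ennreal (indicator A \<omega>)) \<omega> = ennreal (cond_pr M F A \<omega>)"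
    unfolding cond_pr_def real_cond_exp_def neg
    by eventually_elim (auto simp: ennreal_enn2real_if top_unique)
  then have "(\<integral>\<^sup>+\<omega>. Z \<omega> * ennreal (cond_pr M F A \<omega>) \<partial>M)
      = (\<integral>\<^sup>+\<omega>. Z \<omega> * nn_cond_exp M F (\<lambda>\<omega>. ennreal (indicator A \<omega>)) \<omega> \<partial>M)"
    by (intro nn_integral_cong_AE) auto
  also have "\<dots> = (\<integral>\<^sup>+\<omega>. Z \<omega> * ennreal (indicator A \<omega>) \<partial>M)"
    using Z by (intro nn_cond_exp_intg) auto
  finally show ?thesis by (simp add: ennreal_indicator)
qed

section \<open>Sigma-algebras generated by random variables, and joins\<close>

lemma space_sigma_rv [simp]: "space (sigma_rv M XS) = space M"
  unfolding sigma_rv_def by (rule space_measure_of) auto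

lemma sets_sigma_rv: "sets (sigma_rv M XS) =
    sigma_sets (space M) {X -` A \<inter> space M | X A. X \<in> XS \<and> A \<in> sets borel}"
  unfolding sigma_rv_def by (rule sets_measure_of) auto

lemma subalgebra_sigma_rv:
  assumes "XS \<subseteq> borel_measurable M"
  shows "subalgebra M (sigma_rv M XS)"
proof -
  have "{X -` A \<inter> space M | X A. X \<in> XS \<and> A \<in> sets borel} \<subseteq> sets M"
    using assms by (auto intro: measurable_sets)
  then show ?thesis
    by (auto simp: subalgebra_def sets_sigma_rv dest: sets.sigma_sets_subset)
qed

lemma measurable_sigma_rv: "X \<in> XS \<Longrightarrow> X \<in> borel_measurable (sigma_rv M XS)"
  by (rule measurableI) (auto simp: sets_sigma_rv intro!: sigma_sets.Basic)

lemma
  assumes "subalgebra M F" "subalgebra M G"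
  shows subalgebra_sigma_join: "subalgebra M (sigma_join M F G)"
    and subalgebra_sigma_join_left: "subalgebra (sigma_join M F G) F"
    and subalgebra_sigma_join_right: "subalgebra (sigma_join M F G) G"
proof -
  have sub: "sets F \<union> sets G \<subseteq> sets M"
    using assms by (auto simp: subalgebra_def)
  then have pow: "sets F \<union> sets G \<subseteq> Pow (space M)"
    using sets.space_closed by blast
  have [simp]: "space (sigma_join M F G) = space M"
    unfolding sigma_join_def using pow by (rule space_measure_of)
  have sets: "sets (sigma_join M F G) = sigma_sets (space M) (sets F \<union> sets G)"
    unfolding sigma_join_def using pow by (rule sets_measure_of)
  show "subalgebra M (sigma_join M F G)"
    using sets.sigma_sets_subset[OF sub] by (simp add: subalgebra_def sets)
  show "subalgebra (sigma_join M F G) F" "subalgebra (sigma_join M F G) G"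
    using assms by (auto simp: subalgebra_def sets)
qed

section \<open>Laplace transforms along the steps of one block\<close>

text \<open>Integrating the conditional probability shows that \<open>X \<le> 0\<close> has measure
  0. In this way the bounds at \<open>t = 0\<close> supply the nonnegativity that the exponential
  tail formula requires.\<close>

lemma (in finite_measure) AE_nonneg_of_cond_pr_le_0:
  fixes X :: "'a \<Rightarrow> ereal"
  assumes sub: "subalgebra M F" and [measurable]: "X \<in> borel_measurable M"
    and "AE \<omega> in M. cond_pr M F {\<omega>'\<in>space M. X \<omega>' \<le> ereal 0} \<omega> \<le> 0"
  shows "AE \<omega> in M. 0 \<le> X \<omega>"
proof -
  let ?A = "{\<omega>\<in>space M. X \<omega> \<le> ereal 0}"
  have "emeasure M ?A = (\<integral>\<^sup>+\<omega>. 1 * indicator ?A \<omega> \<partial>M)" by simp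
  also have "\<dots> = (\<integral>\<^sup>+\<omega>. 1 * ennreal (cond_pr M F ?A \<omega>) \<partial>M)"
    by (rule nn_integral_mult_indicator_cond_pr[OF sub]) auto
  also have "\<dots> = (\<integral>\<^sup>+\<omega>. 0 \<partial>M)"
    using assms(3) by (intro nn_integral_cong_AE) (auto simp: ennreal_neg)
  finally have "?A \<in> null_sets M" by (auto simp: null_sets_def)
  from AE_not_in[OF this] AE_space show ?thesis
    by eventually_elim (auto simp: zero_ereal_def)
qed

text \<open>\<open>E k\<close> is an event known before step \<open>k\<close> on which the linear
  bound is available. The induction peels off the last step: all other factors are measurable with
  respect to its past and form the weight of \<open>nn_integral_exp_neg_le\<close>.\<close>

lemma (in finite_measure) nn_integral_prod_exp_neg_restrict_le:
  fixes X :: "nat \<Rightarrow> 'a \<Rightarrow> ereal"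
  assumes sub: "\<And>k. 1 \<le> k \<Longrightarrow> subalgebra M (F k)"
    and W: "\<And>k. 1 \<le> k \<Longrightarrow> W \<in> borel_measurable (F k)"
    and X: "\<And>k j. 1 \<le> j \<Longrightarrow> j < k \<Longrightarrow> X j \<in> borel_measurable (F k)"
    and E: "\<And>k j. 1 \<le> j \<Longrightarrow> j \<le> k \<Longrightarrow> E j \<in> sets (F k)"
    and XM: "\<And>k. 1 \<le> k \<Longrightarrow> X k \<in> borel_measurable M"
    and l: "0 < l" and p: "0 \<le> p"
    and pos: "\<And>k. 1 \<le> k \<Longrightarrow> AE \<omega> in M. 0 \<le> X k \<omega>"
    and cdf: "\<And>k t. 1 \<le> k \<Longrightarrow> 0 \<le> t \<Longrightarrow> t * p < 1 \<Longrightarrow>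
      AE \<omega> in M. \<omega> \<in> E k \<longrightarrow> cond_pr M (F k) {\<omega>'\<in>space M. X k \<omega>' \<le> ereal t} \<omega> \<le> t * p"
  shows "(\<integral>\<^sup>+\<omega>. W \<omega> * (\<Prod>k\<in>{1..m}. indicator (E k) \<omega> * exp_neg l (X k \<omega>)) \<partial>M)
      \<le> ennreal (p / l) ^ m * (\<integral>\<^sup>+\<omega>. W \<omega> \<partial>M)"
proof (induction m)
  case (Suc m)
  let ?k = "Suc m"
  let ?Z = "\<lambda>\<omega>. W \<omega> * (\<Prod>k\<in>{1..m}. indicator (E k) \<omega> * exp_neg l (X k \<omega>))"
  \<comment> \<open>The indicator of the last event joins the weight, since the bound for the last
    step holds only on that event; it is dropped again before the induction hypothesis is
    applied.\<close>
  let ?Z' = "\<lambda>\<omega>. ?Z \<omega> * indicator (E ?k) \<omega>"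
  have [measurable]: "W \<in> borel_measurable (F ?k)" "E ?k \<in> sets (F ?k)"
    using W[of ?k] E[of ?k ?k] by auto
  have [measurable]: "E k \<in> sets (F ?k)" "X k \<in> borel_measurable (F ?k)" if "k \<in> {1..m}" for k
    using E[of k ?k] X[of k ?k] that by auto
  have Z'[measurable]: "?Z' \<in> borel_measurable (F ?k)" by measurable
  have [measurable]: "X ?k \<in> borel_measurable M" using XM by simp
  have Z'M: "?Z' \<in> borel_measurable M"
    by (rule measurable_from_subalg[OF sub Z']) simp
  have "(\<integral>\<^sup>+\<omega>. W \<omega> * (\<Prod>k\<in>{1..?k}. indicator (E k) \<omega> * exp_neg l (X k \<omega>)) \<partial>M)
      = (\<integral>\<^sup>+\<omega>. ?Z' \<omega> * exp_neg l (X ?k \<omega>) \<partial>M)"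
    by (simp add: mult_ac)
  also have "\<dots> \<le> ennreal (p / l) * (\<integral>\<^sup>+\<omega>. ?Z' \<omega> \<partial>M)"
  proof (rule nn_integral_exp_neg_le)
    fix t :: real assume t: "0 \<le> t"
    let ?A = "{\<omega>\<in>space M. X ?k \<omega> \<le> ereal t}"
    show "(\<integral>\<^sup>+\<omega>. ?Z' \<omega> * indicator ?A \<omega> \<partial>M) \<le> ennreal (t * p) * (\<integral>\<^sup>+\<omega>. ?Z' \<omega> \<partial>M)"
    proof (cases "t * p < 1")
      case True
      have "(\<integral>\<^sup>+\<omega>. ?Z' \<omega> * indicator ?A \<omega> \<partial>M) = (\<integral>\<^sup>+\<omega>. ?Z' \<omega> * ennreal (cond_pr M (F ?k) ?A \<omega>) \<partial>M)"
        by (rule nn_integral_mult_indicator_cond_pr[OF sub Z']) auto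
      also have "\<dots> \<le> (\<integral>\<^sup>+\<omega>. ennreal (t * p) * ?Z' \<omega> \<partial>M)"
      proof (rule nn_integral_mono_AE)
        have "AE \<omega> in M. \<omega> \<in> E ?k \<longrightarrow> cond_pr M (F ?k) ?A \<omega> \<le> t * p"
          using cdf[of ?k t] t True by simp
        then show "AE \<omega> in M. ?Z' \<omega> * ennreal (cond_pr M (F ?k) ?A \<omega>) \<le> ennreal (t * p) * ?Z' \<omega>"
        proof eventually_elim
          case (elim \<omega>)
          then show ?case
            by (cases "\<omega> \<in> E ?k") (auto simp: mult.commute[of "ennreal (t * p)"] intro!: mult_left_mono ennreal_leI)
        qed
      qed
      also have "\<dots> = ennreal (t * p) * (\<integral>\<^sup>+\<omega>. ?Z' \<omega> \<partial>M)"
        by (rule nn_integral_cmult[OF Z'M])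
      finally show ?thesis .
    next
      case False
      \<comment> \<open>An indicator is at most 1, so for \<open>t * p \<ge> 1\<close> the bound is
        trivial.\<close>
      then have "1 \<le> ennreal (t * p)" using ennreal_leI[of 1 "t * p"] by simp
      have "(\<integral>\<^sup>+\<omega>. ?Z' \<omega> * indicator ?A \<omega> \<partial>M) \<le> 1 * (\<integral>\<^sup>+\<omega>. ?Z' \<omega> \<partial>M)"
        by (auto intro!: nn_integral_mono split: split_indicator)
      also have "\<dots> \<le> ennreal (t * p) * (\<integral>\<^sup>+\<omega>. ?Z' \<omega> \<partial>M)"
        by (intro mult_right_mono) (use \<open>1 \<le> ennreal (t * p)\<close> in auto)
      finally show ?thesis .
    qed
  qed (use l p pos[of ?k] XM[of ?k] Z'M sigma_finite_measure_axioms in \<open>simp_all\<close>)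
  also have "(\<integral>\<^sup>+\<omega>. ?Z' \<omega> \<partial>M) \<le> (\<integral>\<^sup>+\<omega>. ?Z \<omega> \<partial>M)"
    by (auto intro!: nn_integral_mono split: split_indicator)
  also have "ennreal (p / l) * \<dots> \<le> ennreal (p / l) * (ennreal (p / l) ^ m * (\<integral>\<^sup>+\<omega>. W \<omega> \<partial>M))"
    by (rule mult_left_mono[OF Suc]) simp
  finally show ?case by (simp add: mult_left_mono mult.assoc)
qed simp

lemma (in finite_measure) nn_integral_prod_exp_neg_le:
  fixes X :: "nat \<Rightarrow> 'a \<Rightarrow> ereal"
  assumes sub: "\<And>k. 1 \<le> k \<Longrightarrow> subalgebra M (F k)"
    and W: "\<And>k. 1 \<le> k \<Longrightarrow> W \<in> borel_measurable (F k)"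
    and X: "\<And>k j. 1 \<le> j \<Longrightarrow> j < k \<Longrightarrow> X j \<in> borel_measurable (F k)"
    and XM: "\<And>k. 1 \<le> k \<Longrightarrow> X k \<in> borel_measurable M"
    and l: "0 < l" and p: "0 \<le> p"
    and cdf: "\<And>k t. 1 \<le> k \<Longrightarrow> 0 \<le> t \<Longrightarrow>
      AE \<omega> in M. cond_pr M (F k) {\<omega>'\<in>space M. X k \<omega>' \<le> ereal t} \<omega> \<le> t * p"
  shows "(\<integral>\<^sup>+\<omega>. W \<omega> * (\<Prod>k\<in>{1..m}. exp_neg l (X k \<omega>)) \<partial>M)
      \<le> ennreal (p / l) ^ m * (\<integral>\<^sup>+\<omega>. W \<omega> \<partial>M)"
proof -
  have "(\<integral>\<^sup>+\<omega>. W \<omega> * (\<Prod>k\<in>{1..m}. exp_neg l (X k \<omega>)) \<partial>M)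
    = (\<integral>\<^sup>+\<omega>. W \<omega> * (\<Prod>k\<in>{1..m}. indicator (space M) \<omega> * exp_neg l (X k \<omega>)) \<partial>M)"
    by (intro nn_integral_cong) simp
  also have "\<dots> \<le> ennreal (p / l) ^ m * (\<integral>\<^sup>+\<omega>. W \<omega> \<partial>M)"
  proof (rule nn_integral_prod_exp_neg_restrict_le[where F = F and E = "\<lambda>_. space M"])
    show "AE \<omega> in M. 0 \<le> X k \<omega>" if "1 \<le> k" for k
      using AE_nonneg_of_cond_pr_le_0[OF sub XM] cdf[of k 0] that by simp
    show "space M \<in> sets (F k)" if "1 \<le> j" "j \<le> k" for j k :: nat
      using sub[of k] that sets.top[of "F k"] by (simp add: subalgebra_def)
    show "AE \<omega> in M. \<omega> \<in> space M \<longrightarrow> cond_pr M (F k) {\<omega>'\<in>space M. X k \<omega>' \<le> ereal t} \<omega> \<le> t * p"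
      if "1 \<le> k" "0 \<le> t" for k t
      using cdf[OF that] by eventually_elim simp
  qed (use assms in auto)
  finally show ?thesis .
qed

text \<open>As long as the partial sum is at most \<open>d / 2\<close>, the conditional distribution function is at
  most \<open>4 * K * t / d\<close> for every \<open>t\<close>: this bound exceeds 1 once \<open>t > d / 4\<close>. If some partial sum
  exceeds \<open>d / 2\<close>, the exponential is at most \<open>exp (- l * d / 2)\<close>.\<close>

lemma (in finite_measure) nn_integral_prod_exp_neg_budget_le:
  fixes X :: "nat \<Rightarrow> 'a \<Rightarrow> ereal"
  assumes sub: "\<And>k. 1 \<le> k \<Longrightarrow> subalgebra M (F k)"
    and W: "\<And>k. 1 \<le> k \<Longrightarrow> W \<in> borel_measurable (F k)"
    and X: "\<And>k j. 1 \<le> j \<Longrightarrow> j < k \<Longrightarrow> X j \<in> borel_measurable (F k)"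
    and XM: "\<And>k. 1 \<le> k \<Longrightarrow> X k \<in> borel_measurable M"
    and fin: "\<And>k \<omega>. 1 \<le> k \<Longrightarrow> \<omega> \<in> space M \<Longrightarrow> X k \<omega> \<noteq> -\<infinity>"
    and l: "0 < l" and K: "1 \<le> K" and d: "0 < d"
    and cdf: "\<And>k t. 1 \<le> k \<Longrightarrow> 0 \<le> t \<Longrightarrow>
      AE \<omega> in M. ereal t \<le> max (ereal d - (\<Sum>j\<in>{1..<k}. X j \<omega>)) 0 \<longrightarrow>
        ereal (cond_pr M (F k) {\<omega>'\<in>space M. X k \<omega>' \<le> ereal t} \<omega>)
          \<le> ereal (K * t) / (max (ereal d - (\<Sum>j\<in>{1..<k}. X j \<omega>)) 0 - ereal t + 1)"
  shows "(\<integral>\<^sup>+\<omega>. W \<omega> * (\<Prod>k\<in>{1..m}. exp_neg l (X k \<omega>)) \<partial>M)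
      \<le> (ennreal (4 * K / d / l) ^ m + ennreal (exp (- l * d / 2))) * (\<integral>\<^sup>+\<omega>. W \<omega> \<partial>M)"
proof -
  define S where "S k \<omega> = (\<Sum>j\<in>{1..<k}. X j \<omega>)" for k \<omega>
  \<comment> \<open>\<open>S k\<close> stops before index \<open>k\<close>, so \<open>E k\<close>
    belongs to the past \<open>F k\<close>.\<close>
  define E where "E k = {\<omega>\<in>space M. S k \<omega> \<le> ereal (d / 2)}" for k
  let ?e = "ennreal (exp (- l * d / 2))"
  let ?Z = "\<lambda>m \<omega>. \<Prod>k\<in>{1..m}. indicator (E k) \<omega> * exp_neg l (X k \<omega>)"
  have S_fin: "S k \<omega> \<noteq> -\<infinity>" if "\<omega> \<in> space M" for k \<omega>
    unfolding S_def using that fin by (intro sum_ereal_not_MInfty) auto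
  have pos: "AE \<omega> in M. 0 \<le> X k \<omega>" if k: "1 \<le> k" for k
  proof (rule AE_nonneg_of_cond_pr_le_0[OF sub XM])
    show "AE \<omega> in M. cond_pr M (F k) {\<omega>'\<in>space M. X k \<omega>' \<le> ereal 0} \<omega> \<le> 0"
      \<comment> \<open>At \<open>t = 0\<close> the premise of \<open>cdf\<close> always holds and
        the numerator \<open>K * t\<close> is 0.\<close>
      using cdf[OF k order_refl] by eventually_elim (simp add: zero_ereal_def[symmetric])
  qed (use k in auto)
  have E: "E j \<in> sets (F k)" if "1 \<le> j" "j \<le> k" for j k
  proof -
    have [measurable]: "X i \<in> borel_measurable (F k)" if "i \<in> {1..<j}" for i
      using X[of i k] that \<open>j \<le> k\<close> by simp
    have "{\<omega>\<in>space (F k). S j \<omega> \<le> ereal (d / 2)} \<in> sets (F k)"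
      unfolding S_def by measurable
    then show ?thesis using sub[of k] that by (simp add: E_def subalgebra_def)
  qed
  have E_cdf: "AE \<omega> in M. \<omega> \<in> E k \<longrightarrow>
      cond_pr M (F k) {\<omega>'\<in>space M. X k \<omega>' \<le> ereal t} \<omega> \<le> t * (4 * K / d)"
    if k: "1 \<le> k" and t: "0 \<le> t" and small: "t * (4 * K / d) < 1" for k t
  proof -
    \<comment> \<open>This is where \<open>1 \<le> K\<close> enters:
      \<open>4 * t / d \<le> t * (4 * K / d) < 1\<close>.\<close>
    have t4: "t < d / 4"
    proof -
      have "4 * (t * 1) \<le> 4 * (t * K)" using K t by (intro mult_left_mono) auto
      then show ?thesis using small d by (simp add: field_simps)
    qed
    show ?thesis
      using cdf[OF k t]
    proof eventually_elim
      case (elim \<omega>)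
      show ?case
      proof
        assume \<omega>: "\<omega> \<in> E k"
        then obtain r where r: "S k \<omega> = ereal r" "r \<le> d / 2"
          using S_fin[of \<omega> k] by (cases "S k \<omega>") (auto simp: E_def)
        then have R: "max (ereal d - (\<Sum>j\<in>{1..<k}. X j \<omega>)) 0 = ereal (d - r)"
          using d by (simp add: S_def zero_ereal_def max_def)
        have "cond_pr M (F k) {\<omega>'\<in>space M. X k \<omega>' \<le> ereal t} \<omega> \<le> K * t / (d - r - t + 1)"
          using elim r t4 d unfolding R by (simp add: one_ereal_def)
        \<comment> \<open>With \<open>r \<le> d / 2\<close> and \<open>t < d / 4\<close> the
          denominator \<open>d - r - t + 1\<close> exceeds \<open>d / 4\<close>.\<close>
        also have "\<dots> \<le> K * t / (d / 4)"
          using r t4 t K d by (intro divide_left_mono) auto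
        finally show "cond_pr M (F k) {\<omega>'\<in>space M. X k \<omega>' \<le> ereal t} \<omega> \<le> t * (4 * K / d)"
          by (simp add: mult_ac)
      qed
    qed
  qed
  have [measurable]: "X k \<in> borel_measurable M" if "k \<in> {1..m}" for k using XM that by simp
  have [measurable]: "E k \<in> sets M" if "k \<in> {1..m}" for k
    using E[of k k] sub[of k] that by (auto simp: subalgebra_def)
  have [measurable]: "W \<in> borel_measurable M"
    using measurable_from_subalg[OF sub W, of 1] by simp
  have "AE \<omega> in M. \<forall>k\<in>{1..m}. 0 \<le> X k \<omega>"
    using pos by (intro AE_finite_allI) auto
  then have "AE \<omega> in M. (\<Prod>k\<in>{1..m}. exp_neg l (X k \<omega>)) \<le> ?Z m \<omega> + ?e"
    using AE_space
  proof eventually_elim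
    case (elim \<omega>)
    \<comment> \<open>On \<open>E (Suc q)\<close> the new factor is at most 1, so the error
      \<open>?e\<close> does not grow. Off it \<open>?Z (Suc q)\<close> is 0, but the first
      \<open>q\<close> terms already sum to at least \<open>d / 2\<close>, and the next, nonnegative
      term only decreases the exponential.\<close>
    have "(\<Prod>k\<in>{1..q}. exp_neg l (X k \<omega>)) \<le> ?Z q \<omega> + ?e" if "q \<le> m" for q
      using that
    proof (induction q)
      case (Suc q)
      have Xq: "0 \<le> X (Suc q) \<omega>" using elim Suc.prems by simp
      then have le1: "exp_neg l (X (Suc q) \<omega>) \<le> 1"
        using exp_neg_antimono[OF l, of 0 "X (Suc q) \<omega>"] by simp
      show ?case
      proof (cases "\<omega> \<in> E (Suc q)")
        case True
        have "(\<Prod>k\<in>{1..q}. exp_neg l (X k \<omega>)) * exp_neg l (X (Suc q) \<omega>)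
            \<le> (?Z q \<omega> + ?e) * exp_neg l (X (Suc q) \<omega>)"
          using Suc by (intro mult_right_mono) auto
        also have "\<dots> \<le> ?Z q \<omega> * exp_neg l (X (Suc q) \<omega>) + ?e"
          using mult_left_mono[OF le1, of ?e] by (simp add: distrib_right add_left_mono)
        finally show ?thesis using True by (simp add: mult_ac)
      next
        case False
        then have S: "ereal (d / 2) \<le> S (Suc q) \<omega>" using elim by (simp add: E_def)
        have "(\<Prod>k\<in>{1..Suc q}. exp_neg l (X k \<omega>)) = exp_neg l (S (Suc q) \<omega> + X (Suc q) \<omega>)"
          unfolding S_def using elim(2) fin
          by (subst exp_neg_sum[symmetric]) (auto simp: atLeastLessThanSuc_atLeastAtMost add.commute)
        also have "\<dots> \<le> exp_neg l (ereal (d / 2))"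
        proof (rule exp_neg_antimono[OF l])
          show "ereal (d / 2) \<le> S (Suc q) \<omega> + X (Suc q) \<omega>"
            using add_mono[OF S Xq] by simp
        qed simp
        finally show ?thesis using False by simp
      qed
    qed simp
    then show ?case by simp
  qed
  then have "(\<integral>\<^sup>+\<omega>. W \<omega> * (\<Prod>k\<in>{1..m}. exp_neg l (X k \<omega>)) \<partial>M)
      \<le> (\<integral>\<^sup>+\<omega>. W \<omega> * ?Z m \<omega> + ?e * W \<omega> \<partial>M)"
  proof (intro nn_integral_mono_AE, eventually_elim)
    case (elim \<omega>)
    then show ?case
      using mult_left_mono[OF elim(2), of "W \<omega>"] by (simp add: distrib_left mult_ac)
  qed
  also have "\<dots> = (\<integral>\<^sup>+\<omega>. W \<omega> * ?Z m \<omega> \<partial>M) + ?e * (\<integral>\<^sup>+\<omega>. W \<omega> \<partial>M)"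
    by (simp add: nn_integral_add nn_integral_cmult)
  also have "(\<integral>\<^sup>+\<omega>. W \<omega> * ?Z m \<omega> \<partial>M) \<le> ennreal (4 * K / d / l) ^ m * (\<integral>\<^sup>+\<omega>. W \<omega> \<partial>M)"
    by (rule nn_integral_prod_exp_neg_restrict_le[where F = F])
      (use sub W X E XM l pos E_cdf K d in auto)
  finally show ?thesis by (simp add: distrib_right add_right_mono)
qed

section \<open>The numerical estimate behind the constant in \<open>t_bar\<close>\<close>

text \<open>The three terms come from the \<open>\<eta>\<close> steps, the \<open>\<mu>\<close>
  steps and the event that a \<open>\<mu>\<close> sum exceeds \<open>d / 2\<close>. The root in
  \<open>D\<close> becomes \<open>2 * n\<close> in \<open>D ^ m\<close> and absorbs the factor
  \<open>n\<close> in the first two terms; the logarithm does so in the third. With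
  \<open>x = exp (- 4 * m)\<close> they are at most \<open>x / 8\<close>, \<open>x / 4\<close> and
  \<open>x / 4\<close>.\<close>

lemma laplace_rate_bound:
  fixes n m :: nat
  defines "D \<equiv> exp 4 * (2 * real n) powr (1 / real m) * (4 + 1 / real m * ln (2 * real n))"
  assumes n: "1 \<le> n" and m: "1 \<le> m"
  shows "real n * ((1 / D) ^ m + (2 / D) ^ m + exp (- D * (2 * real m))) \<le> exp (- 2 * real m)"
    and "0 < D"
proof -
  define q where "q = (2 * real n) powr (1 / real m)"
  have ln: "0 \<le> ln (2 * real n)" using n by simp
  have q: "1 \<le> q" unfolding q_def using n by (intro ge_one_powr_ge_zero) auto
  have qm: "q ^ m = 2 * real n"
    unfolding q_def using n m by (simp add: powr_realpow[symmetric] powr_powr)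
  have c: "4 \<le> 4 + 1 / real m * ln (2 * real n)" using ln by simp
  have D1: "4 * exp 4 * q \<le> D"
    using mult_left_mono[OF c, of "exp 4 * q"] q unfolding D_def q_def[symmetric]
    by (simp add: mult_ac)
  then show "0 < D" using q by (smt (verit) exp_gt_zero mult_pos_pos)
  have pw: "4 ^ m * exp (4 * real m) * (2 * real n) \<le> D ^ m"
    using power_mono[OF D1, of m] q
    by (simp add: power_mult_distrib qm exp_of_nat_mult[symmetric] mult_ac)
  \<comment> \<open>One factor \<open>2 ^ m\<close> of \<open>4 ^ m\<close> cancels the numerator of
    \<open>(2 / D) ^ m\<close>; the other still supplies a factor 2.\<close>
  have p4: "4 \<le> (4::real) ^ m" "2 \<le> (2::real) ^ m"
    using power_increasing[OF m, of "4::real"] power_increasing[OF m, of "2::real"] by auto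
  have four: "(4::real) ^ m = 2 ^ m * 2 ^ m"
    by (simp add: power_mult_distrib[symmetric])
  let ?x = "exp (- 4 * real m)"
  have a: "real n * (1 / D) ^ m \<le> ?x / 8"
  proof -
    have "4 * exp (4 * real m) * (2 * real n) \<le> D ^ m"
      using order_trans[OF mult_right_mono[OF p4(1), of "exp (4 * real m) * (2 * real n)"] pw[unfolded mult.assoc]]
      by (simp add: mult.assoc)
    from mult_right_mono[OF this, of ?x]
    have "4 * (exp (4 * real m) * ?x) * (2 * real n) \<le> D ^ m * ?x" by (simp add: mult_ac)
    then have "8 * real n \<le> D ^ m * ?x" by (simp add: mult_exp_exp)
    then show ?thesis
      using \<open>0 < D\<close> by (simp add: power_one_over field_simps)
  qed
  have b: "real n * (2 / D) ^ m \<le> ?x / 4"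
  proof -
    have "2 ^ m * 2 * exp (4 * real m) * (2 * real n) \<le> D ^ m"
      using order_trans[OF mult_left_mono[OF p4(2), of "2 ^ m * (exp (4 * real m) * (2 * real n))"]] pw
      by (simp add: four mult_ac)
    from mult_right_mono[OF this, of ?x]
    have "2 ^ m * 2 * (exp (4 * real m) * ?x) * (2 * real n) \<le> D ^ m * ?x" by (simp add: mult_ac)
    then have "2 ^ m * (4 * real n) \<le> D ^ m * ?x" by (simp add: mult_exp_exp)
    then show ?thesis
      using \<open>0 < D\<close> by (simp add: power_divide field_simps)
  qed
  have e: "real n * exp (- D * (2 * real m)) \<le> ?x / 4"
  proof -
    \<comment> \<open>Only the last factor of \<open>D\<close> is kept. Multiplied by
      \<open>2 * m\<close>, its logarithmic term yields \<open>(2 * n) ^ 2\<close> in the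
      denominator, more than enough against \<open>n\<close>.\<close>
    have "1 * (4 + 1 / real m * ln (2 * real n)) \<le> D"
      unfolding D_def q_def[symmetric] using q ln mult_mono[of 1 "exp 4" 1 q]
      by (intro mult_right_mono) auto
    from mult_right_mono[OF this, of "2 * real m"]
    have "8 * real m + 2 * ln (2 * real n) \<le> D * (2 * real m)"
      using m by (simp add: algebra_simps)
    then have "exp (- D * (2 * real m)) \<le> exp (- 4 * real m - 2 * ln (2 * real n))"
      using m by simp
    also have "\<dots> = ?x / (2 * real n) ^ 2"
      using n by (simp add: exp_diff exp_double)
    finally have "real n * exp (- D * (2 * real m)) \<le> real n * (?x / (2 * real n) ^ 2)"
      by (intro mult_left_mono) auto
    also have "\<dots> = ?x / 4 / real n"
      using n by (simp add: power2_eq_square field_simps)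
    also have "\<dots> \<le> ?x / 4"
      using n by (simp add: field_simps)
    finally show ?thesis .
  qed
  have "real n * ((1 / D) ^ m + (2 / D) ^ m + exp (- D * (2 * real m))) \<le> ?x / 8 + ?x / 4 + ?x / 4"
    using a b e by (simp add: algebra_simps)
  also have "\<dots> \<le> ?x" using exp_gt_zero[of "- 4 * real m"] by linarith
  also have "\<dots> \<le> exp (- 2 * real m)" by simp
  finally show "real n * ((1 / D) ^ m + (2 / D) ^ m + exp (- D * (2 * real m))) \<le> exp (- 2 * real m)" .
qed

section \<open>Combination of the blocks and Markov's inequality\<close>

theorem lemmaE3:
  fixes M :: "'a measure"
    and n B d K :: nat
    and h \<tau>\<^sub>s p\<^sub>\<sigma> \<delta> :: real
    and \<eta> \<mu> :: "nat \<Rightarrow> nat \<Rightarrow> nat \<Rightarrow> 'a \<Rightarrow> ereal"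
  assumes "prob_space M"
    and "1 \<le> n" and "1 \<le> B" and "1 \<le> d"
    and "even K" and "1 \<le> K" and "K \<le> d"
    and "0 < h" and "0 < \<tau>\<^sub>s" and "0 < p\<^sub>\<sigma>" and "p\<^sub>\<sigma> \<le> 1" and "0 < \<delta>" and "\<delta> < 1"
    and "\<And>b i k. \<lbrakk>1 \<le> b; i \<in> {1..n}; 1 \<le> k\<rbrakk> \<Longrightarrow> \<eta> b i k \<in> borel_measurable M"
    and "\<And>b i k. \<lbrakk>1 \<le> b; i \<in> {1..n}; 1 \<le> k\<rbrakk> \<Longrightarrow> \<mu> b i k \<in> borel_measurable M"
    and "\<And>b i k \<omega>. \<lbrakk>1 \<le> b; i \<in> {1..n}; 1 \<le> k; \<omega> \<in> space M\<rbrakk> \<Longrightarrow> \<eta> b i k \<omega> \<noteq> -\<infinity>"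
    and "\<And>b i k \<omega>. \<lbrakk>1 \<le> b; i \<in> {1..n}; 1 \<le> k; \<omega> \<in> space M\<rbrakk> \<Longrightarrow> \<mu> b i k \<omega> \<noteq> -\<infinity>"
    and "\<And>b i k (t::real). \<lbrakk>1 \<le> b; i \<in> {1..n}; 1 \<le> k; 0 \<le> t\<rbrakk> \<Longrightarrow>
      AE \<omega> in M.
        cond_pr M (sigma_join M (sigma_rv M {\<eta> b i j | j. j \<in> {1..<k}}) (G_before M n K \<eta> \<mu> b))
          {\<omega>' \<in> space M. \<eta> b i k \<omega>' \<le> ereal t} \<omega>
        \<le> t * p\<^sub>\<sigma>"
    and "\<And>b i k (t::real). \<lbrakk>1 \<le> b; i \<in> {1..n}; 1 \<le> k; 0 \<le> t\<rbrakk> \<Longrightarrow>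
      AE \<omega> in M. ereal t \<le> remaining d \<mu> b i k \<omega> \<longrightarrow>
        ereal (cond_pr M
          (sigma_join M (sigma_rv M {\<mu> b i j | j. j \<in> {1..<k}}) (G_before M n K \<eta> \<mu> b))
          {\<omega>' \<in> space M. \<mu> b i k \<omega>' \<le> ereal t} \<omega>)
        \<le> ereal (real K * t) / (remaining d \<mu> b i k \<omega> - ereal t + 1)"
  shows "measure M {\<omega> \<in> space M.
           (\<Sum>b\<in>{1..B}. MIN i\<in>{1..n}.
              min (ereal h * (\<Sum>k\<in>{1..K div 2}. \<eta> b i k \<omega>))
                  (ereal \<tau>\<^sub>s * (\<Sum>k\<in>{1..K div 2}. \<mu> b i k \<omega>)))
           \<le> ereal (t_bar n B K d h \<tau>\<^sub>s p\<^sub>\<sigma> \<delta>)} \<le> \<delta>"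
proof -
  interpret prob_space M by fact
  note n = assms(2) and d = assms(4) and h = assms(8) and \<tau> = assms(9) and p = assms(10)
    and \<delta> = assms(12) and \<eta>M = assms(14) and \<mu>M = assms(15) and \<eta>fin = assms(16)
    and \<mu>fin = assms(17) and \<eta>cdf = assms(18) and \<mu>cdf = assms(19)
  define m where "m = K div 2"
  have K: "real K = 2 * real m" and m: "1 \<le> m"
    using \<open>even K\<close> \<open>1 \<le> K\<close> by (auto simp: m_def elim!: evenE)
  \<comment> \<open>This is the denominator in \<open>t_bar\<close>, since
    \<open>2 / K = 1 / m\<close>.\<close>
  define D where "D = exp 4 * (2 * real n) powr (1 / real m) * (4 + 1 / real m * ln (2 * real n))"
  have D: "0 < D" unfolding D_def by (rule laplace_rate_bound) (use n m in auto)
  define c where "c = min (h / p\<^sub>\<sigma>) (\<tau>\<^sub>s / p_K K d)"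
  have pK: "0 < p_K K d" using K m d by (simp add: p_K_def)
  have c: "0 < c" "c \<le> h / p\<^sub>\<sigma>" "c \<le> \<tau>\<^sub>s / p_K K d"
    using h p \<tau> pK by (auto simp: c_def)
  \<comment> \<open>As \<open>c\<close> is the smaller of two ratios, this choice gives both
    \<open>s * h \<ge> D * p\<^sub>\<sigma>\<close> and
    \<open>s * \<tau>\<^sub>s \<ge> D * p_K K d\<close>.\<close>
  define s where "s = D / c"
  have s: "0 < s" using D c by (simp add: s_def)
  have st: "s * t_bar n B K d h \<tau>\<^sub>s p\<^sub>\<sigma> \<delta> = real B * real K + ln \<delta>"
  proof -
    have "2 / real K = 1 / real m" using K by simp
    then have "t_bar n B K d h \<tau>\<^sub>s p\<^sub>\<sigma> \<delta> = (real B * real K + ln \<delta>) / D * c"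
      unfolding t_bar_def c_def D_def by simp
    then show ?thesis using D c by (simp add: s_def)
  qed
  let ?G = "G_before M n K \<eta> \<mu>"
  let ?P = "\<lambda>b i \<omega>. \<Prod>k\<in>{1..m}. exp_neg (s * h) (\<eta> b i k \<omega>)"
  let ?Q = "\<lambda>b i \<omega>. \<Prod>k\<in>{1..m}. exp_neg (s * \<tau>\<^sub>s) (\<mu> b i k \<omega>)"
  \<comment> \<open>Replacing the minimum by a sum separates the candidates, so each integral below
    involves one \<open>i\<close> and one family only. This matches the hypotheses, which within a
    block condition only on the past of that single sequence.\<close>
  define V where "V b \<omega> = (\<Sum>i\<in>{1..n}. ?P b i \<omega> + ?Q b i \<omega>)" for b \<omega>
  have subG: "subalgebra M (?G b)" for b
    unfolding G_before_def by (rule subalgebra_sigma_rv) (auto intro: \<eta>M \<mu>M)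
  have G_meas: "\<eta> b' i k \<in> borel_measurable (?G b)" "\<mu> b' i k \<in> borel_measurable (?G b)"
    if "b' \<in> {1..<b}" "i \<in> {1..n}" "k \<in> {1..m}" for b b' i k
    unfolding G_before_def using that by (auto intro!: measurable_sigma_rv simp: m_def)
  have V_meas: "V b' \<in> borel_measurable (?G b)" if "b' \<in> {1..<b}" for b b'
  proof -
    have [measurable]: "\<eta> b' i k \<in> borel_measurable (?G b)" "\<mu> b' i k \<in> borel_measurable (?G b)"
      if "i \<in> {1..n}" "k \<in> {1..m}" for i k
      using G_meas \<open>b' \<in> {1..<b}\<close> that by auto
    show ?thesis unfolding V_def by measurable
  qed
  have [measurable]: "V b \<in> borel_measurable M" if "1 \<le> b" for b
    \<comment> \<open>\<open>?G b\<close> contains only blocks before \<open>b\<close>, so block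
      \<open>b\<close> first appears in \<open>?G (Suc b)\<close>.\<close>
    using measurable_from_subalg[OF subG V_meas, of b "Suc b"] that by simp

  have pP: "(p\<^sub>\<sigma> / (s * h)) ^ m \<le> (1 / D) ^ m"
  proof (rule power_mono)
    have "D * c * p\<^sub>\<sigma> \<le> D * h" using c(2) p D by (simp add: field_simps)
    then show "p\<^sub>\<sigma> / (s * h) \<le> 1 / D" using c D h by (simp add: s_def field_simps)
  qed (use p s h in auto)
  \<comment> \<open>The rate \<open>4 * K / d\<close> of the budget bound is
    \<open>2 * p_K K d\<close>, hence \<open>2 / D\<close> in place of \<open>1 / D\<close>.\<close>
  have pQ: "(4 * real K / real d / (s * \<tau>\<^sub>s)) ^ m \<le> (2 / D) ^ m"
  proof (rule power_mono)
    have "D * c * p_K K d \<le> D * \<tau>\<^sub>s" using c(3) pK D by (simp add: field_simps)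
    then have "2 * p_K K d / (s * \<tau>\<^sub>s) \<le> 2 / D" using c D \<tau> by (simp add: s_def field_simps)
    then show "4 * real K / real d / (s * \<tau>\<^sub>s) \<le> 2 / D" by (simp add: p_K_def)
  qed (use K s \<tau> in auto)
  have eQ: "exp (- (s * \<tau>\<^sub>s) * real d / 2) \<le> exp (- D * (2 * real m))"
  proof -
    have "c * (2 * real K) \<le> \<tau>\<^sub>s * real d"
      using c(3) K m d by (simp add: p_K_def field_simps)
    from mult_left_mono[OF this, of "D / c"] have "D * (2 * real K) \<le> s * \<tau>\<^sub>s * real d"
      using c D by (simp add: s_def field_simps)
    then show ?thesis using K by simp
  qed

  \<comment> \<open>\<open>W\<close> is an arbitrary weight determined by earlier blocks; in the
    induction that follows it is the product of their \<open>V\<close>.\<close>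
  have step: "(\<integral>\<^sup>+\<omega>. W \<omega> * V b \<omega> \<partial>M) \<le> ennreal (exp (- real K)) * (\<integral>\<^sup>+\<omega>. W \<omega> \<partial>M)"
    if W: "W \<in> borel_measurable (?G b)" and b: "1 \<le> b" for W b
  proof -
    let ?I = "\<integral>\<^sup>+\<omega>. W \<omega> \<partial>M"
    have WM [measurable]: "W \<in> borel_measurable M" by (rule measurable_from_subalg[OF subG W])
    have [measurable]: "\<eta> b i k \<in> borel_measurable M" "\<mu> b i k \<in> borel_measurable M"
      if "i \<in> {1..n}" "k \<in> {1..m}" for i k
      using \<eta>M \<mu>M that b by auto
    have P: "(\<integral>\<^sup>+\<omega>. W \<omega> * ?P b i \<omega> \<partial>M) \<le> ennreal ((1 / D) ^ m) * ?I" if i: "i \<in> {1..n}" for i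
    proof -
      define F where "F k = sigma_join M (sigma_rv M {\<eta> b i j | j. j \<in> {1..<k}}) (?G b)" for k
      have sub: "subalgebra M (sigma_rv M {\<eta> b i j | j. j \<in> {1..<k}})" for k
        using \<eta>M b i by (intro subalgebra_sigma_rv) auto
      have "(\<integral>\<^sup>+\<omega>. W \<omega> * ?P b i \<omega> \<partial>M) \<le> ennreal (p\<^sub>\<sigma> / (s * h)) ^ m * ?I"
      proof (rule nn_integral_prod_exp_neg_le[where F = F])
        show "subalgebra M (F k)" for k
          unfolding F_def by (rule subalgebra_sigma_join[OF sub subG])
        show "W \<in> borel_measurable (F k)" for k
          unfolding F_def by (rule measurable_from_subalg[OF subalgebra_sigma_join_right[OF sub subG] W])
        show "\<eta> b i j \<in> borel_measurable (F k)" if "1 \<le> j" "j < k" for k j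
          unfolding F_def using that
          by (intro measurable_from_subalg[OF subalgebra_sigma_join_left[OF sub subG]] measurable_sigma_rv) auto
        show "AE \<omega> in M. cond_pr M (F k) {\<omega>'\<in>space M. \<eta> b i k \<omega>' \<le> ereal t} \<omega> \<le> t * p\<^sub>\<sigma>"
          if "1 \<le> k" "0 \<le> t" for k t
          unfolding F_def using \<eta>cdf[OF b i that] .
      qed (use \<eta>M b i s h p in auto)
      also have "ennreal (p\<^sub>\<sigma> / (s * h)) ^ m \<le> ennreal ((1 / D) ^ m)"
        using pP p s h by (simp add: ennreal_power ennreal_leI)
      finally show ?thesis by (simp add: mult_right_mono)
    qed
    have Q: "(\<integral>\<^sup>+\<omega>. W \<omega> * ?Q b i \<omega> \<partial>M) \<le> ennreal ((2 / D) ^ m + exp (- D * (2 * real m))) * ?I"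
      if i: "i \<in> {1..n}" for i
    proof -
      define F where "F k = sigma_join M (sigma_rv M {\<mu> b i j | j. j \<in> {1..<k}}) (?G b)" for k
      have sub: "subalgebra M (sigma_rv M {\<mu> b i j | j. j \<in> {1..<k}})" for k
        using \<mu>M b i by (intro subalgebra_sigma_rv) auto
      have "(\<integral>\<^sup>+\<omega>. W \<omega> * ?Q b i \<omega> \<partial>M)
        \<le> (ennreal (4 * real K / real d / (s * \<tau>\<^sub>s)) ^ m + ennreal (exp (- (s * \<tau>\<^sub>s) * real d / 2))) * ?I"
      proof (rule nn_integral_prod_exp_neg_budget_le[where F = F])
        show "subalgebra M (F k)" for k
          unfolding F_def by (rule subalgebra_sigma_join[OF sub subG])
        show "W \<in> borel_measurable (F k)" for k
          unfolding F_def by (rule measurable_from_subalg[OF subalgebra_sigma_join_right[OF sub subG] W])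
        show "\<mu> b i j \<in> borel_measurable (F k)" if "1 \<le> j" "j < k" for k j
          unfolding F_def using that
          by (intro measurable_from_subalg[OF subalgebra_sigma_join_left[OF sub subG]] measurable_sigma_rv) auto
        show "AE \<omega> in M. ereal t \<le> max (ereal (real d) - (\<Sum>j\<in>{1..<k}. \<mu> b i j \<omega>)) 0 \<longrightarrow>
            ereal (cond_pr M (F k) {\<omega>'\<in>space M. \<mu> b i k \<omega>' \<le> ereal t} \<omega>)
              \<le> ereal (real K * t) / (max (ereal (real d) - (\<Sum>j\<in>{1..<k}. \<mu> b i j \<omega>)) 0 - ereal t + 1)"
          if "1 \<le> k" "0 \<le> t" for k t
          unfolding F_def using \<mu>cdf[OF b i that] unfolding remaining_def .
      qed (use \<mu>M \<mu>fin b i s \<tau> d \<open>1 \<le> K\<close> in auto)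
      also have "ennreal (4 * real K / real d / (s * \<tau>\<^sub>s)) ^ m + ennreal (exp (- (s * \<tau>\<^sub>s) * real d / 2))
          = ennreal ((4 * real K / real d / (s * \<tau>\<^sub>s)) ^ m + exp (- (s * \<tau>\<^sub>s) * real d / 2))"
        using s \<tau> by (simp add: ennreal_power ennreal_plus)
      also have "\<dots> \<le> ennreal ((2 / D) ^ m + exp (- D * (2 * real m)))"
        by (intro ennreal_leI add_mono pQ eQ)
      finally show ?thesis by (simp add: mult_right_mono)
    qed
    have "(\<integral>\<^sup>+\<omega>. W \<omega> * V b \<omega> \<partial>M)
        = (\<Sum>i\<in>{1..n}. (\<integral>\<^sup>+\<omega>. W \<omega> * ?P b i \<omega> \<partial>M) + (\<integral>\<^sup>+\<omega>. W \<omega> * ?Q b i \<omega> \<partial>M))"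
    proof -
      have "(\<integral>\<^sup>+\<omega>. W \<omega> * V b \<omega> \<partial>M)
          = (\<integral>\<^sup>+\<omega>. (\<Sum>i\<in>{1..n}. W \<omega> * ?P b i \<omega> + W \<omega> * ?Q b i \<omega>) \<partial>M)"
        unfolding V_def sum_distrib_left distrib_left ..
      also have "\<dots> = (\<Sum>i\<in>{1..n}. (\<integral>\<^sup>+\<omega>. W \<omega> * ?P b i \<omega> + W \<omega> * ?Q b i \<omega> \<partial>M))"
        by (rule nn_integral_sum) measurable
      also have "\<dots> = (\<Sum>i\<in>{1..n}. (\<integral>\<^sup>+\<omega>. W \<omega> * ?P b i \<omega> \<partial>M) + (\<integral>\<^sup>+\<omega>. W \<omega> * ?Q b i \<omega> \<partial>M))"
        by (intro sum.cong refl nn_integral_add) measurable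
      finally show ?thesis .
    qed
    also have "\<dots> \<le> (\<Sum>i\<in>{1..n}. ennreal ((1 / D) ^ m) * ?I
        + ennreal ((2 / D) ^ m + exp (- D * (2 * real m))) * ?I)"
      by (intro sum_mono add_mono P Q)
    also have "\<dots> = ennreal (real n * ((1 / D) ^ m + (2 / D) ^ m + exp (- D * (2 * real m)))) * ?I"
      using D by (simp add: distrib_right[symmetric] ennreal_plus[symmetric] ennreal_mult
          ennreal_of_nat_eq_real_of_nat mult.assoc add.assoc del: ennreal_plus)
    also have "\<dots> \<le> ennreal (exp (- real K)) * ?I"
      using laplace_rate_bound(1)[OF n m] K unfolding D_def[symmetric]
      by (intro mult_right_mono ennreal_leI) auto
    finally show ?thesis .
  qed
  have laplace: "(\<integral>\<^sup>+\<omega>. (\<Prod>b\<in>{1..N}. V b \<omega>) \<partial>M) \<le> ennreal (exp (- real K)) ^ N" for N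
  proof (induction N)
    case (Suc N)
    have "(\<lambda>\<omega>. \<Prod>b\<in>{1..N}. V b \<omega>) \<in> borel_measurable (?G (Suc N))"
      by (intro borel_measurable_prod_ennreal V_meas) auto
    from step[OF this] have "(\<integral>\<^sup>+\<omega>. (\<Prod>b\<in>{1..Suc N}. V b \<omega>) \<partial>M)
        \<le> ennreal (exp (- real K)) * (\<integral>\<^sup>+\<omega>. (\<Prod>b\<in>{1..N}. V b \<omega>) \<partial>M)"
      by (simp add: mult.commute)
    also have "\<dots> \<le> ennreal (exp (- real K)) * ennreal (exp (- real K)) ^ N"
      by (rule mult_left_mono[OF Suc]) simp
    finally show ?case by simp
  qed (simp add: emeasure_space_1)

  define Y where "Y b \<omega> = (MIN i\<in>{1..n}.
      min (ereal h * (\<Sum>k\<in>{1..m}. \<eta> b i k \<omega>)) (ereal \<tau>\<^sub>s * (\<Sum>k\<in>{1..m}. \<mu> b i k \<omega>)))" for b \<omega>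
  have Y: "Y b \<omega> \<noteq> -\<infinity>" "exp_neg s (Y b \<omega>) \<le> V b \<omega>" if b: "1 \<le> b" and \<omega>: "\<omega> \<in> space M" for b \<omega>
  proof -
    have "Y b \<omega> \<in> (\<lambda>i. min (ereal h * (\<Sum>k\<in>{1..m}. \<eta> b i k \<omega>))
        (ereal \<tau>\<^sub>s * (\<Sum>k\<in>{1..m}. \<mu> b i k \<omega>))) ` {1..n}"
      unfolding Y_def using n by (intro Min_in) auto
    then obtain i where i: "i \<in> {1..n}" and Yi:
      "Y b \<omega> = min (ereal h * (\<Sum>k\<in>{1..m}. \<eta> b i k \<omega>)) (ereal \<tau>\<^sub>s * (\<Sum>k\<in>{1..m}. \<mu> b i k \<omega>))"
      by auto
    have fin: "(\<Sum>k\<in>{1..m}. \<eta> b i k \<omega>) \<noteq> -\<infinity>" "(\<Sum>k\<in>{1..m}. \<mu> b i k \<omega>) \<noteq> -\<infinity>"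
      using \<eta>fin \<mu>fin b i \<omega> by (auto intro!: sum_ereal_not_MInfty)
    then show "Y b \<omega> \<noteq> -\<infinity>"
      unfolding Yi using h \<tau> by (auto simp: min_def ereal_mult_eq_MInfty)
    \<comment> \<open>For the minimizing index \<open>i\<close>, the exponential of
      \<open>Y b \<omega>\<close> is one of these two products, hence at most their sum.\<close>
    have "exp_neg s (ereal h * (\<Sum>k\<in>{1..m}. \<eta> b i k \<omega>)) = ?P b i \<omega>"
      "exp_neg s (ereal \<tau>\<^sub>s * (\<Sum>k\<in>{1..m}. \<mu> b i k \<omega>)) = ?Q b i \<omega>"
      unfolding exp_neg_scale[OF h fin(1)] exp_neg_scale[OF \<tau> fin(2)]
      using \<eta>fin \<mu>fin b i \<omega> by (auto intro!: exp_neg_sum)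
    then have "exp_neg s (Y b \<omega>) \<le> ?P b i \<omega> + ?Q b i \<omega>"
      unfolding Yi min_def by simp
    also have "\<dots> \<le> V b \<omega>"
      unfolding V_def using i by (intro member_le_sum) auto
    finally show "exp_neg s (Y b \<omega>) \<le> V b \<omega>" .
  qed
  let ?t = "t_bar n B K d h \<tau>\<^sub>s p\<^sub>\<sigma> \<delta>"
  \<comment> \<open>The event in question is enclosed in one stated through the product of the
    \<open>V b\<close>, the form to which Markov's inequality applies.\<close>
  let ?A = "{\<omega>\<in>space M. 1 \<le> ennreal (exp (s * ?t)) * (\<Prod>b\<in>{1..B}. V b \<omega>)}"
  have A: "\<omega> \<in> ?A" if \<omega>: "\<omega> \<in> space M" and le: "(\<Sum>b\<in>{1..B}. Y b \<omega>) \<le> ereal ?t" for \<omega>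
  proof -
    have "ennreal (exp (- s * ?t)) = exp_neg s (ereal ?t)" by simp
    also have "\<dots> \<le> exp_neg s (\<Sum>b\<in>{1..B}. Y b \<omega>)"
      by (rule exp_neg_antimono[OF s _ le], rule sum_ereal_not_MInfty) (use Y \<omega> in auto)
    also have "\<dots> = (\<Prod>b\<in>{1..B}. exp_neg s (Y b \<omega>))"
      by (rule exp_neg_sum) (use Y \<omega> in auto)
    also have "\<dots> \<le> (\<Prod>b\<in>{1..B}. V b \<omega>)"
      by (rule prod_mono_ennreal) (use Y \<omega> in auto)
    finally have "ennreal (exp (s * ?t)) * ennreal (exp (- s * ?t))
        \<le> ennreal (exp (s * ?t)) * (\<Prod>b\<in>{1..B}. V b \<omega>)"
      by (rule mult_left_mono) simp
    then show ?thesis using \<omega> by (simp add: ennreal_mult'[symmetric] mult_exp_exp)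
  qed
  have VB [measurable]: "(\<lambda>\<omega>. \<Prod>b\<in>{1..B}. V b \<omega>) \<in> borel_measurable M" by measurable
  have "emeasure M ?A \<le> ennreal (exp (s * ?t)) * (\<integral>\<^sup>+\<omega>. (\<Prod>b\<in>{1..B}. V b \<omega>) * indicator (space M) \<omega> \<partial>M)"
    by (rule nn_integral_Markov_inequality) measurable
  also have "(\<integral>\<^sup>+\<omega>. (\<Prod>b\<in>{1..B}. V b \<omega>) * indicator (space M) \<omega> \<partial>M) = (\<integral>\<^sup>+\<omega>. (\<Prod>b\<in>{1..B}. V b \<omega>) \<partial>M)"
    by (intro nn_integral_cong) simp
  also have "ennreal (exp (s * ?t)) * \<dots> \<le> ennreal (exp (s * ?t)) * ennreal (exp (- real K)) ^ B"
    by (rule mult_left_mono[OF laplace]) simp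
  \<comment> \<open>By \<open>st\<close> the first exponent is \<open>B * K + ln \<delta>\<close>,
    and its part \<open>B * K\<close> cancels against the \<open>B\<close> factors
    \<open>exp (- K)\<close>.\<close>
  also have "\<dots> = ennreal \<delta>"
    using \<delta> by (simp add: st ennreal_power ennreal_mult'[symmetric] exp_of_nat_mult[symmetric] mult_exp_exp)
  finally have "measure M ?A \<le> \<delta>"
    using \<delta> by (simp add: emeasure_eq_measure)
  moreover have "measure M {\<omega>\<in>space M. (\<Sum>b\<in>{1..B}. Y b \<omega>) \<le> ereal ?t} \<le> measure M ?A"
  proof (rule finite_measure_mono)
    show "?A \<in> sets M" by measurable
  qed (use A in auto)
  ultimately show ?thesis by (simp add: Y_def m_def)
qed

end
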